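(* Let $\alpha\in(0,1)$ and let $X$ and $Y$ be real random variables with $\mathbb{E}|X|<\infty$ and $\mathbb{E}|Y|<\infty$, having probability density functions $f_x$ and $f_y$ respectively, and let $F_Y$ be the cumulative distribution function of $Y$. Let $h:\mathbb{R}\to[0,\infty)$ be a continuous function, let $g(z)=\int_{-\infty}^z h(x)\,dx$, and define $F_{Y^L}(y)=\min(1,F_Y(y)+g(y))$ for $y\in\mathbb{R}$. If $\lim_{z\to-\infty}g(z)=0$ and $f_x(x)\le f_y(x)+h(x)$ for all $x\in\mathbb{R}$, then $F_{Y^L}$ is a cumulative distribution function and, for a random variable $Y^L$ with CDF $F_{Y^L}$, $$\mathrm{CVaR}_\alpha(Y^L)\le\mathrm{CVaR}_\alpha(X).$$
   Context: For a random variable $Z$ and a level $\alpha\in(0,1)$, $\mathrm{CVaR}_\alpha(Z)=\inf_{w\in\mathbb{R}}\{w+\frac{1}{\alpha}\mathbb{E}[(Z-w)^+]\}$, where $(x)^+=\max(x,0)$. It depends only on the distribution of $Z$. $F_Z(z)=P(Z\le z)$ denotes the CDF. A function is a CDF if it is non-decreasing, right-continuous, takes values in $[0,1]$, and has limits $0$ at $-\infty$ and $1$ at $+\infty$. *)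

theory Defs
  imports "HOL-Probability.Probability"
begin

text \<open>
  The expectation of the nonnegative variable \<open>(Z - w)\<^sup>+\<close> is taken in \<open>[0, \<infinity>]\<close>, so the value
  is meaningful for every random variable: no integrability of \<open>Z\<close> is needed, and neither the
  default value of the Bochner integral nor that of the infimum on the reals can interfere.
\<close>

definition CVaR :: "real \<Rightarrow> 'a measure \<Rightarrow> ('a \<Rightarrow> real) \<Rightarrow> ereal" where
  "CVaR \<alpha> M Z =
     (INF w::real. ereal w + ereal (1 / \<alpha>) * enn2ereal (\<integral>\<^sup>+ \<omega>. ennreal (max (Z \<omega> - w) 0) \<partial>M))"

definition is_cdf :: "(real \<Rightarrow> real) \<Rightarrow> bool" where
  "is_cdf F \<longleftrightarrow>
     mono F \<and>
     (\<forall>x. continuous (at_right x) F) \<and>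
     (\<forall>x. 0 \<le> F x \<and> F x \<le> 1) \<and>
     (F \<longlongrightarrow> 0) at_bot \<and>
     (F \<longlongrightarrow> 1) at_top"

end

theory Submission
  imports Defs
begin

text \<open>
  Integrating the density inequality gives \<open>F\<^sub>X \<le> F\<^sub>Y + g\<close>, hence \<open>F\<^sub>X \<le> F\<^sub>Y\<^sub>L\<close>: the variable
  \<open>YL\<close> is stochastically dominated by \<open>X\<close>. By the layer-cake formula, the expectation of
  \<open>(Z - w)\<^sup>+\<close> is the integral of \<open>1 - F\<^sub>Z\<close> over \<open>(w, \<infinity>)\<close>, so CVaR is monotone under stochastic
  dominance.
\<close>

text \<open>For each \<open>\<omega>\<close>, the positive part of \<open>Z \<omega> - w\<close> is
  the Lebesgue measure of the interval of all \<open>t\<close> with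
  \<open>w < t < Z \<omega>\<close>. Writing it as an integral over \<open>t\<close> and swapping
  the two integrals by Tonelli leaves the tail probabilities of \<open>Z\<close>.\<close>

lemma nn_integral_pos_part_eq:
  assumes "sigma_finite_measure M" and [measurable]: "Z \<in> borel_measurable M"
  shows "(\<integral>\<^sup>+\<omega>. ennreal (max (Z \<omega> - w) 0) \<partial>M) =
    (\<integral>\<^sup>+t\<in>{w<..}. emeasure M {\<omega> \<in> space M. t < Z \<omega>} \<partial>lborel)"
proof -
  interpret sigma_finite_measure M by fact
  interpret pair_sigma_finite M lborel ..
  have "(\<integral>\<^sup>+\<omega>. ennreal (max (Z \<omega> - w) 0) \<partial>M) =
      (\<integral>\<^sup>+\<omega>. (\<integral>\<^sup>+t. (if w < t \<and> t < Z \<omega> then 1 else 0) \<partial>lborel) \<partial>M)"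
  proof (rule nn_integral_cong)
    fix \<omega>
    have "(\<integral>\<^sup>+t. (if w < t \<and> t < Z \<omega> then 1 else 0) \<partial>lborel) =
        (\<integral>\<^sup>+t. indicator {w<..<Z \<omega>} t \<partial>lborel)"
      by (intro nn_integral_cong) (auto split: split_indicator)
    also have "\<dots> = ennreal (max (Z \<omega> - w) 0)"
      by (cases "w \<le> Z \<omega>") (auto simp: max_def)
    finally show "ennreal (max (Z \<omega> - w) 0) =
        (\<integral>\<^sup>+t. (if w < t \<and> t < Z \<omega> then 1 else 0) \<partial>lborel)" ..
  qed
  also have "\<dots> = (\<integral>\<^sup>+t. (\<integral>\<^sup>+\<omega>. (if w < t \<and> t < Z \<omega> then 1 else 0) \<partial>M) \<partial>lborel)"
    by (rule Fubini'[symmetric]) measurable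
  also have "\<dots> = (\<integral>\<^sup>+t\<in>{w<..}. emeasure M {\<omega> \<in> space M. t < Z \<omega>} \<partial>lborel)"
  proof (rule nn_integral_cong)
    fix t :: real
    have "(\<integral>\<^sup>+\<omega>. (if w < t \<and> t < Z \<omega> then 1 else 0) \<partial>M) =
        (\<integral>\<^sup>+\<omega>. indicator {w<..} t * indicator {\<omega> \<in> space M. t < Z \<omega>} \<omega> \<partial>M)"
      by (intro nn_integral_cong) (auto split: split_indicator)
    also have "\<dots> = emeasure M {\<omega> \<in> space M. t < Z \<omega>} * indicator {w<..} t"
      by (subst nn_integral_cmult) (auto simp: mult.commute)
    finally show "(\<integral>\<^sup>+\<omega>. (if w < t \<and> t < Z \<omega> then 1 else 0) \<partial>M) =
        emeasure M {\<omega> \<in> space M. t < Z \<omega>} * indicator {w<..} t" .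
  qed
  finally show ?thesis .
qed

lemma (in prob_space) emeasure_greater_eq_cdf:
  assumes [measurable]: "Z \<in> borel_measurable M"
  shows "emeasure M {\<omega> \<in> space M. t < Z \<omega>} = ennreal (1 - cdf (distr M borel Z) t)"
proof -
  have "{\<omega> \<in> space M. t < Z \<omega>} = space M - {\<omega> \<in> space M. Z \<omega> \<le> t}"
    by auto
  moreover have "cdf (distr M borel Z) t = prob {\<omega> \<in> space M. Z \<omega> \<le> t}"
    by (auto simp: cdf_def measure_distr intro!: arg_cong[where f = prob])
  ultimately show ?thesis
    by (simp add: emeasure_eq_measure prob_compl)
qed

text \<open>A smaller cdf means heavier upper tails, so for every fixed \<open>w\<close> the
  expected excess over \<open>w\<close> is at least as large for \<open>X\<close> as for
  \<open>Y\<close>. The infima then compare with the same \<open>w\<close> on both sides. Only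
  distributions enter, so the two variables may live on different spaces.\<close>

lemma CVaR_mono_cdf:
  assumes "prob_space M" "prob_space N"
    and "X \<in> borel_measurable M" "Y \<in> borel_measurable N"
    and "0 \<le> \<alpha>"
    and cdf_le: "\<And>t. cdf (distr M borel X) t \<le> cdf (distr N borel Y) t"
  shows "CVaR \<alpha> N Y \<le> CVaR \<alpha> M X"
proof -
  interpret M: prob_space M by fact
  interpret N: prob_space N by fact
  have "(\<integral>\<^sup>+\<omega>. ennreal (max (Y \<omega> - w) 0) \<partial>N) \<le> (\<integral>\<^sup>+\<omega>. ennreal (max (X \<omega> - w) 0) \<partial>M)" for w
    unfolding nn_integral_pos_part_eq[OF N.sigma_finite_measure_axioms assms(4)]
      nn_integral_pos_part_eq[OF M.sigma_finite_measure_axioms assms(3)]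
      M.emeasure_greater_eq_cdf[OF assms(3)] N.emeasure_greater_eq_cdf[OF assms(4)]
    by (intro nn_integral_mono mult_right_mono ennreal_leI) (auto simp: cdf_le)
  then show ?thesis
    unfolding CVaR_def using \<open>0 \<le> \<alpha>\<close>
    by (intro INF_mono')
      (auto intro!: add_left_mono ereal_mult_left_mono simp: less_eq_ennreal.rep_eq)
qed

lemma cdf_distr_eq_nn_integral_density:
  assumes "prob_space M" "distributed M lborel X (\<lambda>x. ennreal (f x))"
  shows "ennreal (cdf (distr M borel X) t) = (\<integral>\<^sup>+x\<in>{..t}. ennreal (f x) \<partial>lborel)"
proof -
  interpret prob_space M by fact
  have [measurable]: "X \<in> borel_measurable M"
    using distributed_measurable[OF assms(2)] by simp
  have "ennreal (cdf (distr M borel X) t) = emeasure M (X -` {..t} \<inter> space M)"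
    by (simp add: cdf_def measure_distr emeasure_eq_measure)
  then show ?thesis
    by (simp add: distributed_emeasure[OF assms(2)])
qed

text \<open>The limit 0 makes the integral finite far enough to the left, and what remains up to
  \<open>z\<close> is the integral of a continuous function over a compact interval.\<close>

lemma nn_integral_Iic_finite:
  fixes h :: "real \<Rightarrow> real"
  assumes "continuous_on UNIV h"
    and lim: "((\<lambda>z. \<integral>\<^sup>+x\<in>{..z}. ennreal (h x) \<partial>lborel) \<longlongrightarrow> 0) at_bot"
  shows "(\<integral>\<^sup>+x\<in>{..z}. ennreal (h x) \<partial>lborel) < \<infinity>"
proof -
  have [measurable]: "h \<in> borel_measurable borel"
    using assms(1) by (rule borel_measurable_continuous_onI)
  have "\<forall>\<^sub>F a in at_bot. (\<integral>\<^sup>+x\<in>{..a}. ennreal (h x) \<partial>lborel) < 1"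
    using order_tendstoD(2)[OF lim] by simp
  \<comment> \<open>The bound 1 is arbitrary; any finite positive bound would serve.\<close>
  then obtain a where a: "(\<integral>\<^sup>+x\<in>{..a}. ennreal (h x) \<partial>lborel) < 1"
    by (auto simp: eventually_at_bot_linorder)
  have "compact (h ` {a..z})"
    using assms(1) by (intro compact_continuous_image) (auto intro: continuous_on_subset)
  then obtain B where B: "\<And>x. x \<in> {a..z} \<Longrightarrow> h x \<le> B"
    by (meson bounded_imp_bdd_above compact_imp_bounded bdd_above_def imageI bdd_above.E)
  \<comment> \<open>The sets \<open>{..a}\<close> and \<open>{a..z}\<close> cover
    \<open>{..z}\<close>. Their overlap at \<open>a\<close> does no harm to an upper bound, and for
    \<open>z < a\<close> the second set is empty.\<close>
  have "(\<integral>\<^sup>+x\<in>{..z}. ennreal (h x) \<partial>lborel) \<le>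
      (\<integral>\<^sup>+x. ennreal (h x) * indicator {..a} x + ennreal B * indicator {a..z} x \<partial>lborel)"
    by (intro nn_integral_mono) (auto split: split_indicator intro!: ennreal_leI B)
  also have "\<dots> = (\<integral>\<^sup>+x\<in>{..a}. ennreal (h x) \<partial>lborel) + ennreal B * emeasure lborel {a..z}"
    by (subst nn_integral_add) (auto simp: nn_integral_cmult_indicator)
  also have "\<dots> < \<infinity>"
    using a by (auto simp: ennreal_mult_less_top emeasure_lborel_Icc_eq
        intro: less_trans[OF _ ennreal_one_less_top])
  finally show ?thesis .
qed

text \<open>Near \<open>z\<close> the function is the cdf of a finite measure with density
  \<open>h\<close>, and such cdfs are right-continuous.\<close>

lemma continuous_at_right_nn_integral_Iic:
  fixes h :: "real \<Rightarrow> real"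
  assumes [measurable]: "h \<in> borel_measurable borel"
    and fin: "\<And>z. (\<integral>\<^sup>+x\<in>{..z}. ennreal (h x) \<partial>lborel) < \<infinity>"
  shows "continuous (at_right z) (\<lambda>z. enn2real (\<integral>\<^sup>+x\<in>{..z}. ennreal (h x) \<partial>lborel))"
proof -
  \<comment> \<open>The total integral of \<open>h\<close> may be infinite, so the density is cut
    off at \<open>z + 1\<close>. Any cutoff beyond \<open>z\<close> keeps the values at
    \<open>z\<close> and just to its right, which is all that right-continuity sees.\<close>
  define \<nu> where "\<nu> = density lborel (\<lambda>x. ennreal (h x) * indicator {..z + 1} x)"
  interpret finite_borel_measure \<nu>
  proof (intro finite_borel_measure.intro finite_borel_measure_axioms.intro finite_measureI)
    show "emeasure \<nu> (space \<nu>) \<noteq> \<infinity>"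
      using fin[of "z + 1"] by (simp add: \<nu>_def emeasure_density less_top)
  qed (simp add: \<nu>_def)
  have cdf_eq: "cdf \<nu> y = enn2real (\<integral>\<^sup>+x\<in>{..y}. ennreal (h x) \<partial>lborel)" if "y \<le> z + 1" for y
    unfolding cdf_def measure_def \<nu>_def
    using that
    by (subst emeasure_density)
      (auto intro!: arg_cong[where f = enn2real] nn_integral_cong split: split_indicator)
  have "\<forall>\<^sub>F y in at_right z. cdf \<nu> y = enn2real (\<integral>\<^sup>+x\<in>{..y}. ennreal (h x) \<partial>lborel)"
    unfolding eventually_at_right_field
    by (rule exI[of _ "z + 1"]) (simp add: cdf_eq)
  then show ?thesis
    using cdf_is_right_cont[of z] cdf_eq[of z]
    by (simp add: continuous_within tendsto_cong)
qed

theorem theorem2p7: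
  fixes \<alpha> :: real
    and M :: "'a measure" and X :: "'a \<Rightarrow> real"
    and M' :: "'b measure" and Y :: "'b \<Rightarrow> real"
    and f_x f_y h :: "real \<Rightarrow> real"
    and g :: "real \<Rightarrow> ennreal"
    and F_Y F_YL :: "real \<Rightarrow> real"
  assumes alpha: "0 < \<alpha>" "\<alpha> < 1"
    and M: "prob_space M"
    and M': "prob_space M'"
    and X_int: "integrable M X"
    and Y_int: "integrable M' Y"
    and f_x_nonneg: "\<And>x. 0 \<le> f_x x"
    and f_y_nonneg: "\<And>x. 0 \<le> f_y x"
    and X_density: "distributed M lborel X (\<lambda>x. ennreal (f_x x))"
    and Y_density: "distributed M' lborel Y (\<lambda>x. ennreal (f_y x))"
    and F_Y: "F_Y = cdf (distr M' borel Y)"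
    and h_cont: "continuous_on UNIV h"
    and h_nonneg: "\<And>x. 0 \<le> h x"
    and g: "\<And>z. g z = (\<integral>\<^sup>+ x\<in>{..z}. ennreal (h x) \<partial>lborel)"
    and F_YL: "\<And>y. F_YL y = enn2real (min 1 (ennreal (F_Y y) + g y))"
    and g_lim: "(g \<longlongrightarrow> 0) at_bot"
    and f_le: "\<And>x. f_x x \<le> f_y x + h x"
  shows "is_cdf F_YL \<and>
    (\<forall>(N :: 'c measure) (YL :: 'c \<Rightarrow> real).
       prob_space N \<longrightarrow> YL \<in> borel_measurable N \<longrightarrow> cdf (distr N borel YL) = F_YL \<longrightarrow>
       CVaR \<alpha> N YL \<le> CVaR \<alpha> M X)"
proof -
  have [measurable]: "h \<in> borel_measurable borel"
    using h_cont by (rule borel_measurable_continuous_onI)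
  have [measurable]: "X \<in> borel_measurable M" "Y \<in> borel_measurable M'"
    using X_int Y_int by auto
  interpret X: real_distribution "distr M borel X"
    using M by (intro prob_space.real_distribution_distr) auto
  interpret Y: real_distribution "distr M' borel Y"
    using M' by (intro prob_space.real_distribution_distr) auto
  have F_Y_nonneg: "0 \<le> F_Y y" for y
    by (simp add: F_Y Y.cdf_nonneg)
  have [measurable]: "f_y \<in> borel_measurable borel"
    using distributed_real_measurable[OF _ Y_density] f_y_nonneg by simp
  define G where "G z = enn2real (g z)" for z
  \<comment> \<open>\<open>enn2real\<close> sends infinity to 0, so \<open>G\<close> can stand for
    \<open>g\<close> only once \<open>g\<close> is known to be finite.\<close>
  have g_fin: "g z < \<infinity>" for z
    using nn_integral_Iic_finite[OF h_cont, of z] g_lim by (simp add: g[abs_def])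
  have g_eq: "g z = ennreal (G z)" and G_nonneg: "0 \<le> G z" for z
    using g_fin[of z] by (auto simp: G_def)
  have F_YL_eq: "F_YL y = min 1 (F_Y y + G y)" for y
    using F_Y_nonneg[of y] G_nonneg[of y]
    by (simp add: F_YL g_eq min_def flip: ennreal_plus ennreal_1)
  have G_mono: "mono G"
  proof (rule monoI)
    fix x y :: real
    assume "x \<le> y"
    then have "g x \<le> g y"
      unfolding g by (intro nn_integral_mono) (auto split: split_indicator)
    then show "G x \<le> G y"
      by (simp add: g_eq G_nonneg)
  qed
  have G_right: "continuous (at_right z) G" for z
    using continuous_at_right_nn_integral_Iic[of h z] g_fin
    by (simp add: G_def[abs_def] g[abs_def])
  have G_bot: "(G \<longlongrightarrow> 0) at_bot"
    using tendsto_enn2real[of g 0] g_lim by (simp add: G_def[abs_def])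
  have F_Y_mono: "mono F_Y"
    by (auto simp: F_Y intro: monoI Y.cdf_nondecreasing)
  have F_Y_right: "continuous (at_right z) F_Y" for z
    by (simp add: F_Y Y.cdf_is_right_cont)
  have F_Y_bot: "(F_Y \<longlongrightarrow> 0) at_bot" and F_Y_top: "(F_Y \<longlongrightarrow> 1) at_top"
    by (simp_all add: F_Y Y.cdf_lim_at_bot Y.cdf_lim_at_top_prob)
  have "is_cdf F_YL"
    unfolding is_cdf_def
  proof (intro conjI allI)
    show "mono F_YL"
      using F_Y_mono G_mono by (fastforce simp: F_YL_eq mono_def intro: min.mono add_mono)
    show "continuous (at_right x) F_YL" for x
      unfolding F_YL_eq[abs_def]
      by (intro continuous_min continuous_const continuous_add F_Y_right G_right)
    show "0 \<le> F_YL x" "F_YL x \<le> 1" for x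
      using F_Y_nonneg[of x] G_nonneg[of x] by (auto simp: F_YL_eq)
    show "(F_YL \<longlongrightarrow> 0) at_bot"
      using tendsto_min[OF tendsto_const tendsto_add[OF F_Y_bot G_bot], of 1]
      by (simp add: F_YL_eq[abs_def])
    \<comment> \<open>\<open>G\<close> may be unbounded at the right end, so \<open>F_YL\<close> is
      squeezed between \<open>F_Y\<close> and 1 instead of passing to the limit in the sum.\<close>
    show "(F_YL \<longlongrightarrow> 1) at_top"
      using F_Y_top
    proof (rule tendsto_sandwich[rotated 2, OF _ tendsto_const])
      show "\<forall>\<^sub>F x in at_top. F_Y x \<le> F_YL x"
        using G_nonneg by (auto simp: F_YL_eq F_Y Y.cdf_bounded_prob)
      show "\<forall>\<^sub>F x in at_top. F_YL x \<le> 1"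
        by (auto simp: F_YL_eq)
    qed
  qed
  \<comment> \<open>The density inequality is integrated over \<open>{..t}\<close> in the extended
    nonnegative reals, then brought back to the reals.\<close>
  moreover have "cdf (distr M borel X) t \<le> F_YL t" for t
  proof -
    have "ennreal (cdf (distr M borel X) t) = (\<integral>\<^sup>+x\<in>{..t}. ennreal (f_x x) \<partial>lborel)"
      by (rule cdf_distr_eq_nn_integral_density[OF M X_density])
    also have "\<dots> \<le>
        (\<integral>\<^sup>+x. ennreal (f_y x) * indicator {..t} x + ennreal (h x) * indicator {..t} x \<partial>lborel)"
      using f_le f_y_nonneg h_nonneg
      by (intro nn_integral_mono)
        (auto split: split_indicator intro!: ennreal_leI simp flip: ennreal_plus)
    also have "\<dots> = ennreal (F_Y t) + g t"
      unfolding F_Y cdf_distr_eq_nn_integral_density[OF M' Y_density] g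
      by (rule nn_integral_add) auto
    also have "\<dots> = ennreal (F_Y t + G t)"
      by (simp add: g_eq F_Y_nonneg G_nonneg)
    finally have "cdf (distr M borel X) t \<le> F_Y t + G t"
      using F_Y_nonneg[of t] G_nonneg[of t] by (subst (asm) ennreal_le_iff) auto
    \<comment> \<open>Capping at 1 preserves the bound because the cdf of \<open>X\<close> never
      exceeds 1.\<close>
    then show ?thesis
      using X.cdf_bounded_prob[of t] by (simp add: F_YL_eq)
  qed
  then have "CVaR \<alpha> N YL \<le> CVaR \<alpha> M X"
    if "prob_space N" "YL \<in> borel_measurable N" "cdf (distr N borel YL) = F_YL"
    for N :: "'c measure" and YL
    using that alpha by (intro CVaR_mono_cdf[OF M]) auto
  ultimately show ?thesis
    by blast
qed

end
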